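(* Let $n>1$ be an odd integer and let $\zeta\in\mathbb{C}$ be a primitive $n$-th root of unity. Then $$\sum_{\tau\in D(n-1)}\mathrm{sign}(\tau)\prod_{j=1}^{n-1}\frac{1+\zeta^{j-\tau(j)}}{1-\zeta^{j-\tau(j)}}=(-1)^{\frac{n-1}{2}}\,\frac{\left((n-2)!!\right)^2}{n}.$$
   Context: For a positive integer $m$, $D(m)$ denotes the set of all derangements of $\{1,\dots,m\}$, i.e. permutations $\tau$ of $\{1,\dots,m\}$ such that $\tau(j)\neq j$ for all $j=1,\dots,m$. $\mathrm{sign}(\tau)\in\{1,-1\}$ is the sign of the permutation $\tau$. For odd $m\geq 1$, $m!!=m(m-2)(m-4)\cdots 3\cdot 1$ is the double factorial. *)

theory Defs
  imports Complex_Main "HOL-Combinatorics.Permutations"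
begin

definition derangements :: "nat \<Rightarrow> (nat \<Rightarrow> nat) set" where
  "derangements m = {\<tau>. \<tau> permutes {1..m} \<and> (\<forall>j\<in>{1..m}. \<tau> j \<noteq> j)}"

text \<open>The product \<open>m (m - 2) (m - 4) \<cdots>\<close>, down to \<open>1\<close> for odd \<open>m\<close> and down to \<open>2\<close> for even \<open>m\<close>,
  with the usual convention \<open>1\<close> at \<open>m = 0\<close>.\<close>

fun double_fact :: "nat \<Rightarrow> nat" where
  "double_fact 0 = 1"
| "double_fact (Suc 0) = 1"
| "double_fact (Suc (Suc m)) = Suc (Suc m) * double_fact m"

definition primitive_root_of_unity :: "nat \<Rightarrow> complex \<Rightarrow> bool" where
  "primitive_root_of_unity n \<zeta> \<longleftrightarrow>
     n > 0 \<and> \<zeta> ^ n = 1 \<and> (\<forall>k. 0 < k \<and> k < n \<longrightarrow> \<zeta> ^ k \<noteq> 1)"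

end

theory Submission
  imports Defs "Jordan_Normal_Form.Determinant"
begin

text \<open>The sum is the determinant of the \<open>(n - 1) \<times> (n - 1)\<close> minor of the circulant matrix with entries
  \<open>c\<^bsub>jk\<^esub> = (1 + \<zeta>\<^bsup>j-k\<^esup>) / (1 - \<zeta>\<^bsup>j-k\<^esup>)\<close> and zero diagonal. The discrete Fourier transform diagonalises
  the circulant matrix with eigenvalues \<open>0\<close> and \<open>2m - n\<close> for \<open>0 < m < n\<close>, so the minor factors as
  \<open>G D G'\<close>, where \<open>D\<close> is diagonal with entries \<open>(2m - n) / n\<close> and
  \<open>G\<close>, \<open>G'\<close> are the minors of the Fourier matrix and its conjugate. As \<open>det G det G' = n\<^bsup>n-2\<^esup>\<close>, the
  determinant is \<open>(\<Prod>m = 1..<n. 2m - n) / n\<close>.\<close>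

section \<open>Determinants of explicitly given matrices\<close>

lemma mat_mult_mat:
  "mat n n f * mat n n g = mat n n (\<lambda>(i, j). \<Sum>k = 0..<n. f (i, k) * g (k, j))"
  by (rule eq_matI) (auto simp: scalar_prod_def)

lemma det_mat_lower_triangular:
  fixes f :: "nat \<times> nat \<Rightarrow> 'a :: idom"
  assumes "\<And>i j. i < j \<Longrightarrow> j < n \<Longrightarrow> f (i, j) = 0"
  shows "det (mat n n f) = (\<Prod>i = 0..<n. f (i, i))"
  using det_lower_triangular[of n "mat n n f"] assms by (simp add: prod_list_diag_prod)

lemma det_mat_upper_triangular:
  fixes f :: "nat \<times> nat \<Rightarrow> 'a :: idom"
  assumes "\<And>i j. j < i \<Longrightarrow> i < n \<Longrightarrow> f (i, j) = 0"
  shows "det (mat n n f) = (\<Prod>i = 0..<n. f (i, i))"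
  using det_upper_triangular[of "mat n n f" n] assms
  by (simp add: prod_list_diag_prod upper_triangular_def)

lemma det_scale_columns:
  fixes f :: "nat \<times> nat \<Rightarrow> 'a :: comm_ring_1"
  shows "det (mat n n (\<lambda>(i, j). f (i, j) * d j)) = det (mat n n f) * (\<Prod>j = 0..<n. d j)"
proof -
  have "(\<Prod>i = 0..<n. f (i, p i) * d (p i)) = (\<Prod>i = 0..<n. f (i, p i)) * (\<Prod>j = 0..<n. d j)"
    if "p permutes {0..<n}" for p
    using prod.permute[OF that, of d] by (simp add: prod.distrib o_def)
  moreover have "p i < n" if "p permutes {0..<n}" "i < n" for p i
    using permutes_in_image[OF that(1), of i] that(2) by simp
  ultimately show ?thesis
    by (simp add: det_def'[of _ n] sum_distrib_right mult.assoc)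
qed

text \<open>Only the top entry of column 0 is nonzero, so only permutations fixing 0 survive in the
  Leibniz formula. Bordering instead of deleting a row and a column keeps the indices
  \<open>1..<n\<close> unshifted.\<close>

lemma det_first_column_unit:
  fixes a :: "nat \<Rightarrow> nat \<Rightarrow> 'a :: comm_ring_1"
  assumes "n > 0"
  shows "det (mat n n (\<lambda>(i, j). if i = 0 then 1 else if j = 0 then 0 else a i j))
       = (\<Sum>p | p permutes {1..<n}. of_int (sign p) * (\<Prod>i = 1..<n. a i (p i)))"
    (is "det (mat n n ?f) = _")
proof -
  have zero: "(\<Prod>i = 0..<n. ?f (i, p i)) = 0"
    if p: "p permutes {0..<n}" and np: "\<not> p permutes {1..<n}" for p
  proof -
    have "p 0 \<noteq> 0"
    proof
      assume "p 0 = 0"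
      then have "p permutes {1..<n}"
        by (intro permutes_superset[OF p]) (auto simp: not_less_eq_eq)
      with np show False ..
    qed
    \<comment> \<open>The row that \<open>p\<close> sends to column 0 lies below row 0, so its entry
      is zero.\<close>
    moreover obtain i where i: "p i = 0"
      using permutes_surj[OF p] by (metis surjD)
    ultimately have "i \<noteq> 0" by metis
    moreover have "i < n"
      using permutes_in_image[OF p, of i] i assms by simp
    ultimately show ?thesis
      using i by (intro prod_zero) (auto intro!: bexI[of _ i])
  qed
  have keep: "(\<Prod>i = 0..<n. ?f (i, p i)) = (\<Prod>i = 1..<n. a i (p i))"
    if p: "p permutes {1..<n}" for p
  proof -
    have "(\<Prod>i = 0..<n. ?f (i, p i)) = (\<Prod>i = 1..<n. ?f (i, p i))"
      using assms by (simp add: prod.atLeast_Suc_lessThan)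
    also have "\<dots> = (\<Prod>i = 1..<n. a i (p i))"
    proof (rule prod.cong)
      fix i assume "i \<in> {1..<n}"
      then show "?f (i, p i) = a i (p i)"
        using permutes_in_image[OF p, of i] by (auto split: if_splits)
    qed simp
    finally show ?thesis .
  qed
  have "p i < n" if "p permutes {0..<n}" "i < n" for p i
    using permutes_in_image[OF that(1), of i] that(2) by simp
  then have "det (mat n n ?f)
      = (\<Sum>p | p permutes {0..<n}. of_int (sign p) * (\<Prod>i = 0..<n. ?f (i, p i)))"
    by (subst det_def'[of _ n]) (auto intro!: sum.cong prod.cong)
  also have "\<dots> = (\<Sum>p | p permutes {1..<n}. of_int (sign p) * (\<Prod>i = 0..<n. ?f (i, p i)))"
  proof (rule sum.mono_neutral_right)
    show "finite {p. p permutes {0..<n}}"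
      by (simp add: finite_permutations)
    show "{p. p permutes {1..<n}} \<subseteq> {p. p permutes {0..<n}}"
      using permutes_subset[of _ "{1..<n}" "{0..<n}"] by auto
    show "\<forall>p\<in>{p. p permutes {0..<n}} - {p. p permutes {1..<n}}.
        of_int (sign p) * (\<Prod>i = 0..<n. ?f (i, p i)) = 0"
      using zero by (metis (no_types, lifting) Diff_iff mem_Collect_eq mult_zero_right)
  qed
  also have "\<dots> = (\<Sum>p | p permutes {1..<n}. of_int (sign p) * (\<Prod>i = 1..<n. a i (p i)))"
    using keep by (intro sum.cong) auto
  finally show ?thesis .
qed

section \<open>Sums over roots of unity and the product of the eigenvalues\<close>

lemma sum_powers_root_of_unity:
  fixes w :: complex
  assumes "w ^ n = 1" and "w \<noteq> 1"
  shows "(\<Sum>m = 0..<n. w ^ m) = 0"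
  using assms by (simp add: atLeast0LessThan geometric_sum)

lemma sum_index_times_powers_root_of_unity:
  fixes w :: complex
  assumes "w ^ n = 1" and "w \<noteq> 1"
  shows "(\<Sum>m = 0..<n. of_nat m * w ^ m) = of_nat n / (w - 1)"
proof -
  \<comment> \<open>Summation by parts, with a free bound \<open>N\<close> because
    \<open>w ^ n = 1\<close> is only usable after the induction.\<close>
  have "(w - 1) * (\<Sum>m = 0..<N. of_nat m * w ^ m)
      = of_nat N * w ^ N - w * (\<Sum>m = 0..<N. w ^ m)" for N
    by (induction N) (simp_all add: algebra_simps)
  from this[of n] show ?thesis
    using assms by (simp add: sum_powers_root_of_unity field_simps)
qed

lemma fourier_expansion_cayley:
  fixes w :: complex
  assumes "n > 0" and "w ^ n = 1" and "w \<noteq> 1"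
  shows "(\<Sum>m = 1..<n. (2 * of_nat m - of_nat n) / of_nat n * w ^ m) = (w + 1) / (w - 1)"
proof -
  have "(\<Sum>m = 0..<n. (2 * of_nat m - of_nat n) / of_nat n * w ^ m)
      = 2 / of_nat n * (\<Sum>m = 0..<n. of_nat m * w ^ m) - (\<Sum>m = 0..<n. w ^ m)"
    using assms(1)
    by (simp add: sum_distrib_left sum_subtractf [symmetric] field_simps cong: sum.cong)
  also have "\<dots> = 2 / (w - 1)"
    using assms by (simp add: sum_powers_root_of_unity sum_index_times_powers_root_of_unity)
  \<comment> \<open>The term at \<open>m = 0\<close> is \<open>- 1\<close>; removing it gives
    \<open>2 / (w - 1) + 1\<close>.\<close>
  finally show ?thesis
    using assms by (simp add: sum.atLeast_Suc_lessThan field_simps)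
qed

text \<open>The terms for \<open>m\<close> and \<open>n - m\<close> cancel. This is the case
  \<open>w = 1\<close> of the expansion above, needed for the diagonal entries.\<close>

lemma sum_centred_indices:
  "(\<Sum>m = 1..<n. (2 * of_nat m - of_nat n) / of_nat n :: complex) = 0"
proof -
  \<comment> \<open>Separating \<open>c\<close> from the bound makes induction possible; the right
    side vanishes at \<open>N = n\<close>, \<open>c = n\<close>.\<close>
  have "(\<Sum>m = 1..<N. 2 * of_nat m - c :: complex) = (of_nat N - 1) * (of_nat N - c)"
    if "N > 0" for N and c :: complex
    using that
  proof (induction N)
    case (Suc N)
    then show ?case by (cases "N = 0") (simp_all add: algebra_simps)
  qed simp
  from this[of n "of_nat n"] show ?thesis
    by (cases "n = 0") (simp_all flip: sum_divide_distrib)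
qed

text \<open>The factors are the odd numbers from \<open>- (2 * q - 1)\<close> to
  \<open>2 * q - 1\<close>; each absolute value occurs with both signs, giving \<open>q\<close>
  negative factors. The induction strips off the two outermost factors.\<close>

lemma prod_centred_indices:
  "(\<Prod>m = 1..<2 * q + 1. 2 * of_nat m - of_nat (2 * q + 1) :: 'a :: comm_ring_1)
     = (-1) ^ q * of_nat (double_fact (2 * q - 1)) ^ 2"
proof (induction q)
  case (Suc q)
  let ?c = "of_nat (2 * q + 3) :: 'a"
  have df: "double_fact (2 * Suc q - 1) = (2 * q + 1) * double_fact (2 * q - 1)"
    by (cases q) simp_all
  have "(\<Prod>m = 1..<2 * q + 3. 2 * of_nat m - ?c)
      = (2 - ?c) * (\<Prod>m = 2..<2 * q + 2. 2 * of_nat m - ?c) * (2 * of_nat (2 * q + 2) - ?c)"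
    by (simp add: prod.atLeast_Suc_lessThan numeral_2_eq_2 numeral_3_eq_3)
  \<comment> \<open>Raising \<open>m\<close> by 1 and \<open>q\<close> by 1 leaves each factor
    unchanged, so the inner product is that of the induction hypothesis.\<close>
  also have "(\<Prod>m = 2..<2 * q + 2. 2 * of_nat m - ?c)
      = (\<Prod>m = 1..<2 * q + 1. 2 * of_nat m - of_nat (2 * q + 1))"
  proof -
    have "{2..<2 * q + 2} = {Suc 1..<Suc (2 * q + 1)}" by auto
    moreover have "2 * of_nat (Suc m) - ?c = 2 * of_nat m - of_nat (2 * q + 1)" for m by simp
    ultimately show ?thesis by (simp only: prod.shift_bounds_Suc_ivl)
  qed
  finally have "(\<Prod>m = 1..<2 * q + 3. 2 * of_nat m - ?c)
      = (2 - ?c) * ((-1) ^ q * of_nat (double_fact (2 * q - 1)) ^ 2)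
        * (2 * of_nat (2 * q + 2) - ?c)"
    by (simp only: Suc.IH)
  also have "2 - ?c = - of_nat (2 * q + 1)"
    by simp
  also have "2 * of_nat (2 * q + 2) - ?c = of_nat (2 * q + 1)"
    by simp
  also have "- x * (s * y\<^sup>2) * x = - 1 * s * (x * y)\<^sup>2" for x y s :: 'a
    by (simp add: power2_eq_square mult_ac)
  finally have "(\<Prod>m = 1..<2 * q + 3. 2 * of_nat m - ?c)
      = (-1) ^ Suc q * of_nat (double_fact (2 * Suc q - 1)) ^ 2"
    unfolding df of_nat_mult power_Suc .
  moreover have "2 * Suc q + 1 = 2 * q + 3"
    by simp
  ultimately show ?case
    by (simp only:)
qed simp

section \<open>Factorisation of the minor\<close>

text \<open>All matrices are bordered by index 0. Since \<open>z\<close> is unit triangular,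
  \<open>det u\<close> is \<open>det g * det g'\<close> times the product of the \<open>d m\<close>.
  The product \<open>det g * det g'\<close> is read off from \<open>h\<close>, which the unit
  triangular \<open>y\<close> brings to the triangular form \<open>x\<close>.\<close>

lemma det_cayley_minor:
  fixes \<zeta> :: complex
  assumes "n > 0" and "primitive_root_of_unity n \<zeta>"
  shows "(\<Sum>p | p permutes {1..<n}. of_int (sign p) *
            (\<Prod>j = 1..<n. (1 + \<zeta> powi (int j - int (p j))) / (1 - \<zeta> powi (int j - int (p j)))))
       = (\<Prod>m = 1..<n. 2 * of_nat m - of_nat n) / of_nat n"
proof -
  define c where "c j k = (1 + \<zeta> powi (int j - int k)) / (1 - \<zeta> powi (int j - int k))" for j k
  define d :: "nat \<Rightarrow> complex"
    where "d m = (if m = 0 then 1 else (2 * of_nat m - of_nat n) / of_nat n)" for m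
  \<comment> \<open>This is the inverse of the power in \<open>c j k\<close>, which turns
    \<open>c j k\<close> into \<open>(w + 1) / (w - 1)\<close> off the diagonal.\<close>
  define w where "w j k = \<zeta> powi (int k - int j)" for j k
  define g :: "nat \<times> nat \<Rightarrow> complex"
    where "g = (\<lambda>(j, m). if j = 0 then of_bool (m = 0) else \<zeta> powi (- int j * int m))"
  define g' :: "nat \<times> nat \<Rightarrow> complex"
    where "g' = (\<lambda>(m, k). if k = 0 then of_bool (m = 0) else \<zeta> powi (int k * int m))"
  define u where "u = (\<lambda>(i, j). if i = 0 then 1 else if j = 0 then 0 else c i j)"
  define z :: "nat \<times> nat \<Rightarrow> complex" where "z = (\<lambda>(i, j). of_bool (j = 0 \<or> i = j))"
  define y :: "nat \<times> nat \<Rightarrow> complex"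
    where "y = (\<lambda>(i, j). if i = j then 1 else if j = 0 then - 1 / of_nat n else 0)"
  define x :: "nat \<times> nat \<Rightarrow> complex"
    where "x = (\<lambda>(i, j). if i = 0 then (if j = 0 then 1 / of_nat n else 1)
                        else if i = j then of_nat n else 0)"
  have n: "n > 0" and zn: "\<zeta> ^ n = 1" and zk: "\<And>k. 0 < k \<Longrightarrow> k < n \<Longrightarrow> \<zeta> ^ k \<noteq> 1"
    using assms by (auto simp: primitive_root_of_unity_def)
  have z0: "\<zeta> \<noteq> 0" using n zn by (auto simp: power_0_left)
  have w_self: "w j j = 1" for j
    by (simp add: w_def)
  have w_root: "w j k ^ n = 1" for j k
  proof -
    have "w j k ^ n = (\<zeta> powi int n) powi (int k - int j)"
      unfolding w_def power_int_of_nat [symmetric] power_int_mult [symmetric]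
      by (simp add: mult.commute)
    then show ?thesis using zn by simp
  qed
  have w_neq: "w j k \<noteq> 1" if "j < n" "k < n" "j \<noteq> k" for j k
  proof
    assume eq: "w j k = 1"
    have "\<zeta> ^ j = \<zeta> ^ k"
      using eq z0 by (simp add: w_def power_int_diff)
    then have "\<zeta> ^ (max j k - min j k) = 1"
      using z0 by (cases "j \<le> k") (simp_all add: power_diff max_def min_def)
    then show False using zk[of "max j k - min j k"] that by auto
  qed
  have gg': "g (j, m) * g' (m, k) = w j k ^ m" if "j \<noteq> 0" "k \<noteq> 0" for j k m
  proof -
    have "g (j, m) * g' (m, k) = \<zeta> powi (- int j * int m + int k * int m)"
      using that z0 by (subst power_int_add) (simp_all add: g_def g'_def)
    also have "- int j * int m + int k * int m = (int k - int j) * int m"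
      by (simp add: algebra_simps)
    finally show ?thesis
      by (simp add: w_def power_int_mult)
  qed
  have c_eq: "(\<Sum>m = 1..<n. d m * w j k ^ m) = c j k" if "j < n" "k < n" for j k
  proof (cases "j = k")
    case True
    \<comment> \<open>On the diagonal \<open>c j j\<close> is \<open>2 / 0 = 0\<close>, in agreement
      with the vanishing sum of the \<open>d m\<close>.\<close>
    have "(\<Sum>m = 1..<n. d m) = (\<Sum>m = 1..<n. (2 * of_nat m - of_nat n) / of_nat n)"
      by (intro sum.cong) (auto simp: d_def)
    then show ?thesis
      using True by (simp add: w_self c_def sum_centred_indices[simplified])
  next
    case False
    have inv: "\<zeta> powi (int j - int k) = inverse (w j k)"
      by (simp add: w_def flip: power_int_minus)
    have w0: "w j k \<noteq> 0" using z0 by (simp add: w_def)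
    have "(\<Sum>m = 1..<n. d m * w j k ^ m)
        = (\<Sum>m = 1..<n. (2 * of_nat m - of_nat n) / of_nat n * w j k ^ m)"
      by (intro sum.cong) (auto simp: d_def)
    also have "\<dots> = (w j k + 1) / (w j k - 1)"
      using n w_root w_neq[OF that False] by (rule fourier_expansion_cayley)
    also have "\<dots> = c j k"
      unfolding c_def inv using w_neq[OF that False] w0 by (simp add: field_simps)
    finally show ?thesis .
  qed
  have split0: "sum f {0..<n} = f 0 + sum f {1..<n}" for f :: "nat \<Rightarrow> complex"
    using n by (simp add: sum.atLeast_Suc_lessThan)

  \<comment> \<open>Bordering by index \<open>0\<close>: \<open>G = [[1, 0], [1, \<zeta>\<^bsup>-jm\<^esup>]]\<close> and \<open>G' = [[1, 1], [0, \<zeta>\<^bsup>mk\<^esup>]]\<close> complete the geometric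
    sums over \<open>m\<close> to full periods, while \<open>G D G' = [[1, 1], [1, 1 + c]] = [[1, 0], [1, I]] [[1, 1], [0, c]]\<close>.\<close>
  have ZU: "mat n n z * mat n n u = mat n n (\<lambda>(j, m). g (j, m) * d m) * mat n n g'"
    unfolding mat_mult_mat
  proof (rule cong_mat, simp_all, goal_cases)
    case (1 j k)
    have "(\<Sum>i = 0..<n. z (j, i) * u (i, k)) = (if j = 0 then 1 else 1 + u (j, k))"
    proof (cases "j = 0")
      case True
      then show ?thesis
        using 1 by (simp add: split0) (simp add: z_def u_def)
    next
      case False
      have "(\<Sum>i = 1..<n. z (j, i) * u (i, k)) = (\<Sum>i = 1..<n. if i = j then u (j, k) else 0)"
        using False by (intro sum.cong) (auto simp: z_def)
      then show ?thesis
        using False 1 by (simp add: split0) (simp add: z_def u_def)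
    qed
    moreover have "(\<Sum>m = 0..<n. g (j, m) * d m * g' (m, k)) = (if j = 0 then 1 else 1 + u (j, k))"
    proof -
      \<comment> \<open>The term at \<open>m = 0\<close> is 1 for all \<open>j\<close> and
        \<open>k\<close>, as \<open>d 0 = 1\<close>; the other terms must yield \<open>u\<close>
        below row 0.\<close>
      have "(\<Sum>m = 1..<n. g (j, m) * d m * g' (m, k)) = (if j = 0 then 0 else u (j, k))"
      proof (cases "j = 0 \<or> k = 0")
        case True
        then show ?thesis
          by (auto simp: g_def g'_def u_def intro!: sum.neutral)
      next
        case False
        have "(\<Sum>m = 1..<n. g (j, m) * d m * g' (m, k)) = (\<Sum>m = 1..<n. d m * w j k ^ m)"
          using gg'[of j k] False by (intro sum.cong) (auto simp: mult_ac)
        then show ?thesis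
          using c_eq[of j k] 1 False by (simp add: u_def)
      qed
      then show ?thesis
        by (simp add: split0) (simp add: g_def g'_def d_def)
    qed
    ultimately show ?case by simp
  qed

  define h :: "nat \<times> nat \<Rightarrow> complex"
    where "h = (\<lambda>(j, k). if j = 0 \<or> k = 0 then 1 else if j = k then of_nat n else 0)"
  \<comment> \<open>Orthogonality of the characters: off the border, the sum over the full period is
    \<open>n\<close> or 0.\<close>
  have GG': "mat n n g * mat n n g' = mat n n h"
    unfolding mat_mult_mat
  proof (rule cong_mat, simp_all, goal_cases)
    case (1 j k)
    show ?case
    proof (cases "j = 0 \<or> k = 0")
      case True
      then have "(\<Sum>m = 1..<n. g (j, m) * g' (m, k)) = 0"
        by (auto simp: g_def g'_def intro!: sum.neutral)
      then show ?thesis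
        using True by (simp add: split0) (auto simp add: g_def g'_def h_def)
    next
      case False
      then have "(\<Sum>m = 0..<n. g (j, m) * g' (m, k)) = (\<Sum>m = 0..<n. w j k ^ m)"
        by (simp add: gg')
      also have "\<dots> = h (j, k)"
        using False w_self[of j] w_root[of j k] w_neq[of j k] 1
        by (cases "j = k") (simp_all add: h_def sum_powers_root_of_unity)
      finally show ?thesis .
    qed
  qed

  \<comment> \<open>Column operation: \<open>1 / n\<close> times every other column is subtracted
    from column 0. This clears it below the corner, where \<open>1 - (n - 1) / n = 1 / n\<close>
    remains.\<close>
  have HY: "mat n n h * mat n n y = mat n n x"
    unfolding mat_mult_mat
  proof (rule cong_mat, simp_all, goal_cases)
    case (1 j k)
    show ?case
    proof (cases "k = 0")
      case True
      have "(\<Sum>m = 1..<n. h (j, m) * y (m, k))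
          = (\<Sum>m = 1..<n. if j = 0 then - 1 / of_nat n else if m = j then - 1 else 0)"
        using True n by (intro sum.cong) (auto simp: h_def y_def)
      then show ?thesis
        using True 1 n
        by (simp add: split0) (auto simp: h_def y_def x_def field_simps of_nat_diff)
    next
      case False
      have "(\<Sum>m = 0..<n. h (j, m) * y (m, k)) = (\<Sum>m = 0..<n. if m = k then h (j, k) else 0)"
        using False by (intro sum.cong) (auto simp: y_def)
      then show ?thesis
        using False 1 by (auto simp: h_def x_def)
    qed
  qed

  have detZ: "det (mat n n z) = 1"
    by (subst det_mat_lower_triangular) (auto simp: z_def)
  have detY: "det (mat n n y) = 1"
    by (subst det_mat_lower_triangular) (auto simp: y_def)
  have "det (mat n n x) = (\<Prod>i = 0..<n. x (i, i))"
    by (rule det_mat_upper_triangular) (auto simp: x_def)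
  also have "\<dots> = of_nat n ^ (n - 1) / of_nat n"
    using n by (simp add: prod.atLeast_Suc_lessThan x_def)
  finally have detX: "det (mat n n x) = of_nat n ^ (n - 1) / of_nat n" .
  have "det (mat n n g) * det (mat n n g') = of_nat n ^ (n - 1) / of_nat n"
    using arg_cong[OF GG', of det] arg_cong[OF HY, of det] detX detY
    by (simp add: det_mult[of _ n])
  moreover have "det (mat n n u) = det (mat n n g) * det (mat n n g') * (\<Prod>m = 0..<n. d m)"
    using arg_cong[OF ZU, of det] detZ by (simp add: det_mult[of _ n] det_scale_columns)
  moreover have "(\<Prod>m = 0..<n. d m)
      = (\<Prod>m = 1..<n. 2 * of_nat m - of_nat n) / of_nat n ^ (n - 1)"
  proof -
    have "(\<Prod>m = 0..<n. d m) = (\<Prod>m = 1..<n. d m)"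
      using n by (simp add: prod.atLeast_Suc_lessThan d_def)
    also have "\<dots> = (\<Prod>m = 1..<n. (2 * of_nat m - of_nat n) / of_nat n)"
      by (intro prod.cong) (auto simp: d_def)
    finally show ?thesis by (simp add: prod_dividef)
  qed
  \<comment> \<open>The powers \<open>n ^ (n - 1)\<close> cancel; the surviving \<open>1 / n\<close>
    is the corner entry of \<open>x\<close>.\<close>
  ultimately have "det (mat n n u) = of_nat n ^ (n - 1) / of_nat n
      * ((\<Prod>m = 1..<n. 2 * of_nat m - of_nat n) / of_nat n ^ (n - 1))"
    by (simp only:)
  then have "det (mat n n u) = (\<Prod>m = 1..<n. 2 * of_nat m - of_nat n) / of_nat n"
    using n by simp
  moreover have "det (mat n n u)
      = (\<Sum>p | p permutes {1..<n}. of_int (sign p) * (\<Prod>j = 1..<n. c j (p j)))"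
    unfolding u_def by (rule det_first_column_unit[OF n])
  ultimately show ?thesis by (simp add: c_def)
qed

theorem theorem1p2:
  fixes n :: nat and \<zeta> :: complex
  assumes "n > 1" and "odd n" and "primitive_root_of_unity n \<zeta>"
  shows "(\<Sum>\<tau>\<in>derangements (n - 1).
            of_int (sign \<tau>) *
            (\<Prod>j\<in>{1..n - 1}. (1 + \<zeta> powi (int j - int (\<tau> j))) / (1 - \<zeta> powi (int j - int (\<tau> j)))))
         = (-1) ^ ((n - 1) div 2) * of_nat (double_fact (n - 2)) ^ 2 / of_nat n"
proof -
  define c where "c j k = (1 + \<zeta> powi (int j - int k)) / (1 - \<zeta> powi (int j - int k))" for j k
  have ivl: "{1..n - 1} = {1..<n}" using assms(1) by auto
  obtain q where q: "n = 2 * q + 1" using assms(2) by (elim oddE)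
  \<comment> \<open>A fixed point contributes the factor \<open>2 / 0 = 0\<close>, so the sum may range over all permutations.\<close>
  have "(\<Sum>\<tau>\<in>derangements (n - 1). of_int (sign \<tau>) * (\<Prod>j\<in>{1..n - 1}. c j (\<tau> j)))
      = (\<Sum>\<tau> | \<tau> permutes {1..<n}. of_int (sign \<tau>) * (\<Prod>j = 1..<n. c j (\<tau> j)))"
    unfolding derangements_def ivl
  proof (rule sum.mono_neutral_left)
    show "finite {\<tau>. \<tau> permutes {1..<n}}"
      by (simp add: finite_permutations)
    have "(\<Prod>j = 1..<n. c j (\<tau> j)) = 0" if "j \<in> {1..<n}" "\<tau> j = j" for \<tau> j
      using that by (intro prod_zero) (auto simp: c_def intro!: bexI[of _ j])
    then show "\<forall>\<tau>\<in>{\<tau>. \<tau> permutes {1..<n}} -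
          {\<tau>. \<tau> permutes {1..<n} \<and> (\<forall>j\<in>{1..<n}. \<tau> j \<noteq> j)}.
        of_int (sign \<tau>) * (\<Prod>j = 1..<n. c j (\<tau> j)) = 0"
      by fastforce
  qed auto
  also have "\<dots> = (\<Prod>m = 1..<n. 2 * of_nat m - of_nat n) / of_nat n"
    unfolding c_def using assms by (intro det_cayley_minor) auto
  \<comment> \<open>Oddness of \<open>n\<close> enters through \<open>q\<close>: no factor
    \<open>2 * m - n\<close> is zero.\<close>
  also have "\<dots> = (-1) ^ ((n - 1) div 2) * of_nat (double_fact (n - 2)) ^ 2 / of_nat n"
    unfolding q prod_centred_indices by simp
  finally show ?thesis by (simp only: c_def)
qed

end
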